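(* If two ellipsoids $\eta$ and $\xi$ in $\mathbb{R}^n$ satisfy $\eta\subseteq\xi$, then $$\xi\subseteq 2\frac{|\xi|}{|\eta|}\cdot\eta.$$ Moreover, if $\eta\subseteq\xi$ and $\eta$ and $\xi$ have the same center, then $\xi\subseteq\frac{|\xi|}{|\eta|}\cdot\eta$.
   Context: $|E|$ denotes Lebesgue measure, and $\mathbb{B}^n$ is the closed Euclidean unit ball of $\mathbb{R}^n$. An ellipsoid in $\mathbb{R}^n$ is a set $\xi=M_\xi(\mathbb{B}^n)+c_\xi$ with $M_\xi$ a nonsingular real $n\times n$ matrix and $c_\xi\in\mathbb{R}^n$ its center. For $\lambda>0$, the dilated ellipsoid is $\lambda\cdot\xi:=\lambda M_\xi(\mathbb{B}^n)+c_\xi$ (dilation about the center of $\xi$). *)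

theory Defs
  imports "HOL-Analysis.Analysis"
begin

definition ellipsoid :: "real^'n^'n \<Rightarrow> real^'n \<Rightarrow> (real^'n) set" where
  "ellipsoid M c = (\<lambda>x. M *v x + c) ` cball 0 1"

text \<open>The dilate of \<open>ellipsoid M c\<close> by the factor \<open>r > 0\<close> about its center \<open>c\<close>.
  For nonsingular \<open>M\<close> it depends only on the set \<open>ellipsoid M c\<close> and on \<open>r\<close>,
  not on the representing pair.\<close>

definition dilated_ellipsoid :: "real \<Rightarrow> real^'n^'n \<Rightarrow> real^'n \<Rightarrow> (real^'n) set" where
  "dilated_ellipsoid r M c = (\<lambda>x. r *\<^sub>R (M *v x) + c) ` cball 0 1"

end

theory Submission
  imports Defs
begin

text \<open>An affine change of coordinates makes the outer ellipsoid the unit ball and the inner one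
  the image of the unit ball under \<open>N\<close>, translated by \<open>d\<close>. Central symmetry makes \<open>N\<close> a
  contraction, and \<open>\<bar>det N\<bar>\<close> is the inverse of the volume ratio \<open>r\<close>. A contraction shrinks no
  vector by more than the factor \<open>\<bar>det N\<bar>\<close>, because the other singular values are at most 1.
  Hence \<open>x - d\<close>, of norm at most 2 (at most 1 if the centers agree), has an \<open>N\<close>-preimage
  at most \<open>r\<close> times as long.\<close>

section \<open>Determinants and the volume of linear images\<close>

lemma row_mat_1: "row i (mat 1 :: 'a::semiring_1^'n^'n) = axis i 1"
  by (auto simp: vec_eq_iff row_def mat_def axis_def)

text \<open>Cramer's rule for the identity matrix, where the solution vector is \<open>a\<close>
  itself. It later evaluates \<open>det T\<close>.\<close>

lemma det_axis_replace_row: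
  fixes a :: "'a::field^'n"
  shows "det (\<chi> i. if i = k then a else axis i 1) = a $ k"
  using cramer_lemma_transpose[of k a "mat 1"] by (simp add: row_mat_1 basis_expansion cong: if_cong)

text \<open>Swapping coordinates carries a box to the box with swapped corners, which only permutes
  the factors of the product of side lengths.\<close>

lemma measure_transpose_cbox:
  fixes a b :: "real^'n" and m n :: 'n
  defines "f \<equiv> \<lambda>x::real^'n. \<chi> i. x $ Transposition.transpose m n i"
  shows "measure lebesgue (f ` cbox a b) = measure lebesgue (cbox a b)"
proof (cases "cbox a b = {}")
  case False
  have ff: "f (f x) = x" for x
    by (simp add: f_def vec_eq_iff)
  have all_iff: "(\<forall>i. Q (Transposition.transpose m n i)) \<longleftrightarrow> (\<forall>i. Q i)" for Q
    by (metis transpose_involutory)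
  have mem: "f x \<in> cbox (f u) (f v) \<longleftrightarrow> x \<in> cbox u v" for x u v
    unfolding mem_box_cart f_def vec_lambda_beta
    by (rule all_iff[of "\<lambda>i. u $ i \<le> x $ i \<and> x $ i \<le> v $ i"])
  have img: "f ` cbox a b = cbox (f a) (f b)"
  proof
    show "f ` cbox a b \<subseteq> cbox (f a) (f b)"
      using mem by blast
    show "cbox (f a) (f b) \<subseteq> f ` cbox a b"
      using mem[of "f _" a b] ff by (metis image_eqI subsetI)
  qed
  have "(\<Prod>i\<in>UNIV. f b $ i - f a $ i) = (\<Prod>i\<in>UNIV. b $ i - a $ i)"
    unfolding f_def
    using prod.permute[OF permutes_swap_id[of m UNIV n], of "\<lambda>i. b $ i - a $ i"] by (simp add: o_def)
  moreover have "cbox (f a) (f b) \<noteq> {}"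
    using False img by blast
  ultimately show ?thesis
    using False by (simp add: img content_cbox_cart)
qed simp

text \<open>By additivity of the shear, translating the box to lower corner 0 changes neither
  volume; \<open>measure_shear_interval\<close> applies there.\<close>

lemma measure_shear_cbox:
  fixes a b :: "real^'n" and m n :: 'n
  assumes "m \<noteq> n"
  defines "f \<equiv> \<lambda>x::real^'n. \<chi> i. if i = m then x $ m + x $ n else x $ i"
  shows "measure lebesgue (f ` cbox a b) = measure lebesgue (cbox a b)"
proof (cases "cbox a b = {}")
  case False
  have shift: "cbox a b = (+) a ` cbox 0 (b - a)"
    using cbox_translation[of a 0 "b - a"] by simp
  have "f (a + x) = f a + f x" for x
    by (simp add: f_def vec_eq_iff)
  then have "f ` cbox a b = (+) (f a) ` f ` cbox 0 (b - a)"
    by (simp add: shift image_image)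
  then have "measure lebesgue (f ` cbox a b) = measure lebesgue (f ` cbox 0 (b - a))"
    by (simp only: measure_translation)
  also have "\<dots> = measure lebesgue (cbox 0 (b - a))"
    unfolding f_def using False shift by (intro measure_shear_interval assms(1)) auto
  also have "\<dots> = measure lebesgue (cbox a b)"
    by (simp only: shift measure_translation)
  finally show ?thesis .
qed simp

text \<open>The library's \<open>measure_linear_image\<close> needs a well-ordered index type;
  the order only serves there to compute the determinant of a shear.\<close>

lemma
  fixes A :: "real^'n^'n"
  assumes "S \<in> lmeasurable"
  shows measurable_matrix_image: "(*v) A ` S \<in> lmeasurable"
    and measure_matrix_image: "measure lebesgue ((*v) A ` S) = \<bar>det A\<bar> * measure lebesgue S"
proof -
  \<comment> \<open>Quantifying over all sets inside \<open>P\<close> lets the product case apply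
    the claim for \<open>A\<close> to the image under \<open>B\<close>.\<close>
  define P where "P A \<longleftrightarrow> (\<forall>S\<in>lmeasurable. (*v) A ` S \<in> lmeasurable \<and>
    measure lebesgue ((*v) A ` S) = \<bar>det A\<bar> * measure lebesgue S)" for A :: "real^'n^'n"
  \<comment> \<open>For determinant 1 or -1, preservation of box volumes suffices; this serves swaps
    and shears.\<close>
  have unimodular: "P A"
    if "\<bar>det A\<bar> = 1" "\<And>a b. measure lebesgue ((*v) A ` cbox a b) = measure lebesgue (cbox a b)" for A
    unfolding P_def
  proof
    fix S :: "(real^'n) set" assume "S \<in> lmeasurable"
    then show "(*v) A ` S \<in> lmeasurable \<and> measure lebesgue ((*v) A ` S) = \<bar>det A\<bar> * measure lebesgue S"
      using measure_linear_sufficient[of "(*v) A" S 1] that by simp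
  qed
  have "P A"
  proof (rule induct_matrix_elementary_alt)
    fix A B :: "real^'n^'n" assume "P A" "P B"
    moreover have "(*v) (A ** B) ` S = (*v) A ` (*v) B ` S" for S
      by (simp add: image_image matrix_vector_mul_assoc)
    ultimately show "P (A ** B)"
      by (simp add: P_def det_mul abs_mult)
  next
    fix A :: "real^'n^'n" and i assume "row i A = 0"
    then have "det A = 0"
      by (rule det_zero_row)
    moreover from this have "\<not> inj ((*v) A)"
      using invertible_det_nz inj_matrix_vector_mult[of A] det_nz_iff_inj[of "(*v) A"] by auto
    then have "negligible ((*v) A ` S)" for S
      by (intro negligible_linear_singular_image) auto
    ultimately show "P A"
      by (simp add: P_def negligible_iff_measure)
  next
    fix A :: "real^'n^'n" assume diag: "\<And>i j. i \<noteq> j \<Longrightarrow> A $ i $ j = 0"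
    have "A *v x = (\<chi> i. A $ i $ i * x $ i)" for x
    proof -
      have "(\<Sum>j\<in>UNIV. A $ i $ j * x $ j) = A $ i $ i * x $ i" for i
        using diag by (simp add: sum.remove[of _ i])
      then show ?thesis
        by (simp add: matrix_vector_mult_def)
    qed
    then have "(*v) A = (\<lambda>x. \<chi> i. A $ i $ i * x $ i)"
      by blast
    then show "P A"
      by (simp add: P_def det_diagonal[OF diag] measurable_stretch measure_stretch)
  next
    fix m n :: 'n assume "m \<noteq> n"
    let ?A = "(\<chi> i j. mat 1 $ i $ Transposition.transpose m n j) :: real^'n^'n"
    have "?A *v x = (\<chi> i. x $ Transposition.transpose m n i)" for x
    proof -
      have "?A $ i = axis (Transposition.transpose m n i) 1" for i
        by (auto simp: vec_eq_iff mat_def axis_def)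
      then show ?thesis
        by (simp add: vec_eq_iff matrix_vector_mul_component inner_axis')
    qed
    then have "(*v) ?A = (\<lambda>x. \<chi> i. x $ Transposition.transpose m n i)"
      by blast
    then show "P ?A"
      by (intro unimodular) (simp_all only: measure_transpose_cbox,
          simp add: det_permute_columns permutes_swap_id sign_swap_id abs_mult)
  next
    fix m n :: 'n assume mn: "m \<noteq> n"
    let ?A = "(\<chi> i j. of_bool (i = m \<and> j = n \<or> i = j)) :: real^'n^'n"
    \<comment> \<open>The shear as a row operation on the identity, which makes its determinant
      1.\<close>
    have A: "?A = (\<chi> i. if i = m then row m (mat 1) + 1 *s row n (mat 1) else row i (mat 1))"
      using mn by (auto simp: vec_eq_iff row_def mat_def)
    have "?A *v x = (\<chi> i. if i = m then x $ m + x $ n else x $ i)" for x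
      unfolding A
      by (simp add: row_mat_1 vec_eq_iff matrix_vector_mul_component inner_add_left inner_axis')
    then have "(*v) ?A = (\<lambda>x. \<chi> i. if i = m then x $ m + x $ n else x $ i)"
      by blast
    moreover have "det ?A = 1"
      unfolding A by (simp only: det_row_operation[OF mn] det_I)
    ultimately show "P ?A"
      using measure_shear_cbox[OF mn] by (intro unimodular) simp_all
  qed
  then show "(*v) A ` S \<in> lmeasurable"
    and "measure lebesgue ((*v) A ` S) = \<bar>det A\<bar> * measure lebesgue S"
    using assms by (auto simp: P_def)
qed

section \<open>Determinants of contractions\<close>

text \<open>The unit ball is mapped into itself, so the volume factor is at most 1.\<close>

lemma abs_det_contraction_le_1:
  fixes N :: "real^'n^'n"
  assumes "\<And>v. norm (N *v v) \<le> norm v"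
  shows "\<bar>det N\<bar> \<le> 1"
proof -
  have "(*v) N ` cball 0 1 \<subseteq> cball 0 1"
    using assms order_trans by fastforce
  then have "measure lebesgue ((*v) N ` cball 0 1) \<le> measure lebesgue (cball (0::real^'n) 1)"
    by (intro measure_mono_fmeasurable fmeasurableD[OF measurable_matrix_image]) auto
  then have "\<bar>det N\<bar> * measure lebesgue (cball (0::real^'n) 1) \<le> 1 * measure lebesgue (cball (0::real^'n) 1)"
    by (simp add: measure_matrix_image)
  moreover have "measure lebesgue (cball (0::real^'n) 1) > 0"
    using content_cball_pos[of 1 "0::real^'n"] by simp
  ultimately show ?thesis
    by (simp only: mult_le_cancel_right_pos)
qed

lemma abs_det_contraction_le_norm_axis:
  fixes N :: "real^'n^'n"
  assumes contr: "\<And>v. norm (N *v v) \<le> norm v" and nz: "N *v axis k 1 \<noteq> 0"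
  shows "\<bar>det N\<bar> \<le> norm (N *v axis k 1)"
proof -
  \<comment> \<open>\<open>T\<close> is chosen so that \<open>N ** T\<close> sends the \<open>k\<close>-th unit vector to the unit vector \<open>u\<close>
    and its orthogonal complement into that of \<open>u\<close>, as the projection of \<open>N\<close>;
    hence \<open>N ** T\<close> is still a contraction, while \<open>det T = 1 / s\<close>.\<close>
  define s where "s = norm (N *v axis k 1)"
  define u where "u = (1/s) *\<^sub>R (N *v axis k 1)"
  \<comment> \<open>Since \<open>u\<close> has inner product \<open>s\<close> with column
    \<open>k\<close> of \<open>N\<close>, entry \<open>k\<close> of \<open>a\<close> is 1 + (1 -
    s)/s = 1/s. The other entries make \<open>N ** T\<close> replace the \<open>u\<close>-component
    of \<open>N *v v\<close> by \<open>v $ k\<close>.\<close>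
  define a where "a = axis k 1 + (1/s) *\<^sub>R (axis k 1 - transpose N *v u)"
  define T :: "real^'n^'n" where "T = (\<chi> i. if i = k then a else axis i 1)"
  have s: "s > 0" and Ne: "N *v axis k 1 = s *\<^sub>R u" and u: "u \<bullet> u = 1"
    using nz by (auto simp: s_def u_def dot_square_norm power2_eq_square)
  have "a $ k = 1 / s"
  proof -
    have "(transpose N *v u) $ k = u \<bullet> (N *v axis k 1)"
      by (metis dot_lmul_matrix inner_axis inner_real_def mult.right_neutral transpose_matrix_vector)
    then show ?thesis
      using s u by (simp add: a_def Ne field_simps)
  qed
  then have det: "det (N ** T) = det N / s"
    by (simp add: det_mul T_def det_axis_replace_row)
  have "norm ((N ** T) *v v) \<le> norm v" for v
  proof -
    \<comment> \<open>Dropping coordinate \<open>k\<close> from \<open>v\<close> changes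
      \<open>N *v v\<close> only along \<open>u\<close>, so both have the same part orthogonal to
      \<open>u\<close>.\<close>
    define g where "g = N *v (v - v $ k *\<^sub>R axis k 1)"
    have g: "g = N *v v - (v $ k * s) *\<^sub>R u"
      by (simp add: g_def matrix_vector_mult_diff_distrib matrix_vector_mult_scaleR Ne)
    have "T *v v = v + (a \<bullet> v - v $ k) *\<^sub>R axis k 1"
      by (auto simp: vec_eq_iff matrix_vector_mul_component T_def inner_axis') (simp add: axis_def)
    then have "(N ** T) *v v = N *v v + ((a \<bullet> v - v $ k) * s) *\<^sub>R u"
      by (simp add: matrix_vector_mul_assoc[symmetric] matrix_vector_right_distrib
          matrix_vector_mult_scaleR Ne)
    moreover have "(a \<bullet> v - v $ k) * s = v $ k - u \<bullet> (N *v v)"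
    proof -
      have "(transpose N *v u) \<bullet> v = u \<bullet> (N *v v)"
        by (simp add: dot_lmul_matrix transpose_matrix_vector)
      then show ?thesis
        using s by (simp add: a_def inner_add_left inner_diff_left inner_axis' field_simps)
    qed
    ultimately have "(N ** T) *v v = N *v v + (v $ k - u \<bullet> (N *v v)) *\<^sub>R u"
      by simp
    then have eq: "(N ** T) *v v = g + (v $ k - u \<bullet> g) *\<^sub>R u"
      by (simp add: g inner_diff_right u algebra_simps)
    \<comment> \<open>Pythagoras: the part of \<open>g\<close> orthogonal to \<open>u\<close> plus
      \<open>v $ k\<close> times the unit vector \<open>u\<close>.\<close>
    have "(norm ((N ** T) *v v))\<^sup>2 = (norm g)\<^sup>2 - (u \<bullet> g)\<^sup>2 + (v $ k)\<^sup>2"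
      unfolding eq power2_norm_eq_inner
      using u by (simp add: inner_add_left inner_add_right inner_commute power2_eq_square algebra_simps)
    also have "\<dots> \<le> (norm (v - v $ k *\<^sub>R axis k 1))\<^sup>2 + (v $ k)\<^sup>2"
      using power_mono[OF contr[of "v - v $ k *\<^sub>R axis k 1"] norm_ge_zero, of 2]
        zero_le_power2[of "u \<bullet> g"]
      unfolding g_def by linarith
    also have "\<dots> = (norm v)\<^sup>2"
      unfolding power2_norm_eq_inner
      by (simp add: inner_diff_left inner_diff_right inner_axis inner_axis' power2_eq_square
          del: dot_square_norm)
    finally show ?thesis
      by (simp add: power2_le_iff_abs_le)
  qed
  then have "\<bar>det (N ** T)\<bar> \<le> 1"
    by (rule abs_det_contraction_le_1)
  then show ?thesis
    using s by (simp add: det s_def[symmetric])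
qed

text \<open>An orthogonal map taking a unit axis vector to the direction of \<open>w\<close>
  preserves both contractivity and the absolute determinant, which reduces the claim to an axis
  vector.\<close>

lemma abs_det_contraction_mult_norm_le:
  fixes N :: "real^'n^'n"
  assumes contr: "\<And>v. norm (N *v v) \<le> norm v" and inv: "invertible N"
  shows "\<bar>det N\<bar> * norm w \<le> norm (N *v w)"
proof (cases "w = 0")
  case False
  fix k :: 'n
  obtain f :: "real^'n \<Rightarrow> real^'n"
    where f: "orthogonal_transformation f" "f (axis k 1) = (1 / norm w) *\<^sub>R w"
    using orthogonal_transformation_exists_1[of "axis k 1" "(1 / norm w) *\<^sub>R w"] False by auto
  define Q where "Q = matrix f"
  have Q: "orthogonal_matrix Q" and Qf: "Q *v v = f v" for v
    using f by (auto simp: Q_def orthogonal_transformation_matrix matrix_works)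
  have "norm ((N ** Q) *v v) \<le> norm v" for v
    using contr[of "Q *v v"] f
    by (simp add: matrix_vector_mul_assoc[symmetric] Qf orthogonal_transformation_norm)
  moreover have Nw: "(N ** Q) *v axis k 1 = (1 / norm w) *\<^sub>R (N *v w)"
    by (simp add: matrix_vector_mul_assoc[symmetric] Qf f matrix_vector_mult_scaleR)
  moreover have "N *v w \<noteq> 0"
    using inv False matrix_left_invertible_ker[of N] unfolding invertible_def by blast
  ultimately have "\<bar>det (N ** Q)\<bar> \<le> norm ((1 / norm w) *\<^sub>R (N *v w))"
    using abs_det_contraction_le_norm_axis[of "N ** Q" k] False by auto
  moreover have "\<bar>det Q\<bar> = 1"
    using det_orthogonal_matrix[OF Q] by auto
  ultimately show ?thesis
    using False by (simp add: det_mul abs_mult field_simps)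
qed simp

section \<open>Ellipsoids and their inclusions\<close>

lemma measure_ellipsoid:
  fixes M :: "real^'n^'n"
  shows "measure lebesgue (ellipsoid M c) = \<bar>det M\<bar> * measure lebesgue (cball (0::real^'n) 1)"
proof -
  have "ellipsoid M c = (+) c ` (*v) M ` cball 0 1"
    by (simp add: ellipsoid_def image_image add.commute)
  then show ?thesis
    by (simp add: measure_translation measure_matrix_image)
qed

text \<open>The vector 2 \<open>N *v x\<close> is the difference of two opposite points of the
  ellipsoid, both of norm at most 1; homogeneity then extends the bound from the unit ball.\<close>

lemma ellipsoid_subset_cball_contraction:
  fixes N :: "real^'n^'n"
  assumes "ellipsoid N d \<subseteq> cball 0 1"
  shows "norm (N *v v) \<le> norm v" and "norm d \<le> 1"
proof -
  have shift: "norm (N *v x + d) \<le> 1" if "norm x \<le> 1" for x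
    using subsetD[OF assms, of "N *v x + d"] that by (auto simp: ellipsoid_def)
  show "norm d \<le> 1"
    using shift[of 0] by simp
  have unit: "norm (N *v x) \<le> 1" if x: "norm x \<le> 1" for x
  proof -
    have "norm (N *v (- x) + d) \<le> 1"
      using shift[of "- x"] x by simp
    moreover have "2 *\<^sub>R (N *v x) = (N *v x + d) - (N *v (- x) + d)"
      by (simp add: vec.neg scaleR_2)
    then have "2 * norm (N *v x) \<le> norm (N *v x + d) + norm (N *v (- x) + d)"
      using norm_triangle_ineq4[of "N *v x + d" "N *v (- x) + d"] by (metis abs_numeral norm_scaleR)
    ultimately show ?thesis
      using shift[OF x] by linarith
  qed
  show "norm (N *v v) \<le> norm v"
  proof (cases "v = 0")
    case False
    then show ?thesis
      using unit[of "(1 / norm v) *\<^sub>R v"] by (simp add: matrix_vector_mult_scaleR field_simps)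
  qed simp
qed

text \<open>Pulling a point back by \<open>B'\<close> relative to the center \<open>d\<close> and
  dividing by \<open>r\<close> lands in the unit ball. Both dilation factors of the theorem are
  obtained this way.\<close>

lemma ellipsoid_subset_dilated:
  fixes A B B' :: "real^'n^'n"
  assumes B: "B ** B' = mat 1" and r: "r > 0"
    and bound: "\<And>x. norm x \<le> 1 \<Longrightarrow> norm (B' *v (A *v x + c - d)) \<le> r"
  shows "ellipsoid A c \<subseteq> dilated_ellipsoid r B d"
proof
  fix y assume "y \<in> ellipsoid A c"
  then obtain x where x: "norm x \<le> 1" "y = A *v x + c"
    by (auto simp: ellipsoid_def)
  define z where "z = (1/r) *\<^sub>R (B' *v (y - d))"
  have "norm z \<le> 1"
    using bound[OF x(1)] r x(2) by (simp add: z_def)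
  moreover have "y = r *\<^sub>R (B *v z) + d"
    using r by (simp add: z_def matrix_vector_mult_scaleR matrix_vector_mul_assoc B)
  ultimately show "y \<in> dilated_ellipsoid r B d"
    by (auto simp: dilated_ellipsoid_def)
qed

theorem theorem2p1:
  fixes M\<^sub>\<eta> M\<^sub>\<xi> :: "real^'n^'n" and c\<^sub>\<eta> c\<^sub>\<xi> :: "real^'n" and \<eta> \<xi> :: "(real^'n) set"
  assumes "invertible M\<^sub>\<eta>" and "\<eta> = ellipsoid M\<^sub>\<eta> c\<^sub>\<eta>"
    and "invertible M\<^sub>\<xi>" and "\<xi> = ellipsoid M\<^sub>\<xi> c\<^sub>\<xi>"
    and "\<eta> \<subseteq> \<xi>"
  shows "\<xi> \<subseteq> dilated_ellipsoid (2 * (measure lebesgue \<xi> / measure lebesgue \<eta>)) M\<^sub>\<eta> c\<^sub>\<eta>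
    \<and> (c\<^sub>\<eta> = c\<^sub>\<xi> \<longrightarrow>
        \<xi> \<subseteq> dilated_ellipsoid (measure lebesgue \<xi> / measure lebesgue \<eta>) M\<^sub>\<eta> c\<^sub>\<eta>)"
proof -
  obtain M\<^sub>\<eta>' M\<^sub>\<xi>' where inv\<^sub>\<eta>: "M\<^sub>\<eta> ** M\<^sub>\<eta>' = mat 1"
    and inv\<^sub>\<xi>: "M\<^sub>\<xi> ** M\<^sub>\<xi>' = mat 1" "M\<^sub>\<xi>' ** M\<^sub>\<xi> = mat 1"
    using assms(1,3) unfolding invertible_def by blast
  define r where "r = measure lebesgue \<xi> / measure lebesgue \<eta>"
  \<comment> \<open>In the coordinates where \<xi> is the unit ball, \<eta> becomes
    \<open>ellipsoid N d\<close>.\<close>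
  define N where "N = M\<^sub>\<xi>' ** M\<^sub>\<eta>"
  define d where "d = M\<^sub>\<xi>' *v (c\<^sub>\<eta> - c\<^sub>\<xi>)"
  have dets: "det M\<^sub>\<eta> \<noteq> 0" "det M\<^sub>\<xi> \<noteq> 0"
    using assms(1,3) by (auto simp: invertible_det_nz)
  have "measure lebesgue (cball (0::real^'n) 1) \<noteq> 0"
    using content_cball_pos[of 1 "0::real^'n"] by simp
  then have r: "r = \<bar>det M\<^sub>\<xi>\<bar> / \<bar>det M\<^sub>\<eta>\<bar>" "r > 0"
    using dets by (auto simp: r_def assms measure_ellipsoid)
  have MN: "M\<^sub>\<xi> ** N = M\<^sub>\<eta>"
    by (simp add: N_def matrix_mul_assoc inv\<^sub>\<xi>)
  then have "det M\<^sub>\<xi> * det N = det M\<^sub>\<eta>"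
    by (metis det_mul)
  then have detN: "\<bar>det N\<bar> = 1 / r" and invN: "invertible N"
    using dets by (auto simp: r(1) invertible_det_nz field_simps simp flip: abs_mult)
  have "ellipsoid N d \<subseteq> cball 0 1"
  proof
    fix y assume "y \<in> ellipsoid N d"
    then obtain x where x: "norm x \<le> 1" "y = N *v x + d"
      by (auto simp: ellipsoid_def)
    then have "M\<^sub>\<eta> *v x + c\<^sub>\<eta> \<in> \<xi>"
      using assms(2,5) by (auto simp: ellipsoid_def)
    then obtain z where z: "norm z \<le> 1" "M\<^sub>\<eta> *v x + c\<^sub>\<eta> = M\<^sub>\<xi> *v z + c\<^sub>\<xi>"
      using assms(4) by (auto simp: ellipsoid_def)
    have "y = M\<^sub>\<xi>' *v (M\<^sub>\<eta> *v x + (c\<^sub>\<eta> - c\<^sub>\<xi>))"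
      by (simp add: x N_def d_def matrix_vector_right_distrib matrix_vector_mul_assoc)
    also have "M\<^sub>\<eta> *v x + (c\<^sub>\<eta> - c\<^sub>\<xi>) = M\<^sub>\<xi> *v z"
      using z(2) by (simp add: algebra_simps)
    finally show "y \<in> cball 0 1"
      using z(1) by (simp add: matrix_vector_mul_assoc inv\<^sub>\<xi>)
  qed
  note contr = ellipsoid_subset_cball_contraction[OF this]
  have expand: "norm v \<le> r * norm (N *v v)" for v
    using abs_det_contraction_mult_norm_le[OF contr(1) invN, of v] r(2) detN
    by (simp add: field_simps)
  \<comment> \<open>The vector on the left is the \<open>N\<close>-preimage of \<open>x - d\<close>,
    so \<open>expand\<close> bounds it.\<close>
  have bound: "norm (M\<^sub>\<eta>' *v (M\<^sub>\<xi> *v x + c\<^sub>\<xi> - c\<^sub>\<eta>)) \<le> r * norm (x - d)" for x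
  proof -
    have "N *v (M\<^sub>\<eta>' *v (M\<^sub>\<xi> *v x + c\<^sub>\<xi> - c\<^sub>\<eta>)) = M\<^sub>\<xi>' *v (M\<^sub>\<xi> *v x + c\<^sub>\<xi> - c\<^sub>\<eta>)"
      by (simp add: N_def matrix_vector_mul_assoc matrix_mul_assoc[symmetric] inv\<^sub>\<eta>)
    also have "\<dots> = x - d"
      by (simp add: d_def matrix_vector_right_distrib matrix_vector_mult_diff_distrib
          matrix_vector_mul_assoc inv\<^sub>\<xi>)
    finally show ?thesis
      using expand by metis
  qed
  \<comment> \<open>The source of the factor 2: \<open>x\<close> and the transformed center
    \<open>d\<close> both lie in the unit ball.\<close>
  have "norm (x - d) \<le> 2" if "norm x \<le> 1" for x
    using norm_triangle_ineq4[of x d] contr(2) that by linarith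
  then have "\<xi> \<subseteq> dilated_ellipsoid (2 * r) M\<^sub>\<eta> c\<^sub>\<eta>"
    unfolding assms(4) using r(2)
    by (intro ellipsoid_subset_dilated[OF inv\<^sub>\<eta>] order_trans[OF bound]) auto
  moreover have "\<xi> \<subseteq> dilated_ellipsoid r M\<^sub>\<eta> c\<^sub>\<eta>" if "c\<^sub>\<eta> = c\<^sub>\<xi>"
  proof -
    \<comment> \<open>With a common center, \<open>x - d\<close> is \<open>x\<close>, of norm at
      most 1, and the factor 2 disappears.\<close>
    have "d = 0"
      using that by (simp add: d_def)
    then show ?thesis
      unfolding assms(4) using r(2)
      by (intro ellipsoid_subset_dilated[OF inv\<^sub>\<eta>] order_trans[OF bound]) auto
  qed
  ultimately show ?thesis
    by (simp add: r_def)
qed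

end
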